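(* Let $\mu$ be a predicate with predicate function $h:\mathcal X\to\mathbb R$, let $0\le\underline t\le\overline t$ and $0\le\underline t'\le\overline t'$ be reals, and set $\Theta=[0,\overline t'-\underline t']$, $\alpha(\tau)=\underline t+\underline t'+\tau$, $\beta(\tau)=\overline t+\underline t'+\tau$ for $\tau\in\Theta$. Let $x$ be a trajectory of $\dot x=f(x,u)$ under an admissible input. Then for every $t_0\in\mathbb R$ the following are equivalent: (a) there exists $\tau:\mathbb R\to\Theta$ such that for all $t\in[t_0,t_0+\beta(\tau(t_0))]$: $\mathbf T_{\alpha,\beta}^{\Theta}V_h(x(t),t;t_0)\ge0$ (with bounds evaluated at $\tau(t_0)$); (b) $(x,t_0)\models F_{[\underline t',\overline t']}G_{[\underline t,\overline t]}\mu$.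
   Context: System: $\dot x=f(x,u)$, $x\in\mathcal X\subseteq\mathbb R^n$, $f$ locally Lipschitz, $u\in\mathcal U\subset\mathbb R^m$ with $\mathcal U$ convex and bounded (admissible inputs). Predicate: $\mu$ is true at $x$ iff $h(x)\ge0$. STL semantics for a signal $x$: $(x,t)\models\mu$ iff $h(x(t))\ge0$; $(x,t)\models F_{[a,b]}\phi$ iff $\exists t_1\in[t+a,t+b]$ with $(x,t_1)\models\phi$; $(x,t)\models G_{[a,b]}\phi$ iff $(x,t_1)\models\phi$ for all $t_1\in[t+a,t+b]$. Value function, for $t\le 0$: $V_h(x,t)=\sup_{u\in\mathcal U}\max_{s\in[t,0]}h(x(s))$ over trajectories starting from $x$ at time $t$. It is a standing assumption that $V_h$ is well defined and is the viscosity solution of $\partial_tV_h+\max_{u\in\mathcal U}(\nabla_xV_h)^\top f(x,u)=0$, $V_h(x,0)=h(x)$. CBF-STL operator: $\mathbf T_{\alpha,\beta}^{\Theta}V_h(x,t;t_0)=V_h(x,t-\alpha(\tau)-t_0)$ for $t\in[t_0,t_0+\alpha(\tau)]$, and $=h(x)$ for $t\in(t_0+\alpha(\tau),t_0+\beta(\tau)]$, for a parameter $\tau\in\Theta$. *)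

theory Defs
  imports "HOL-Analysis.Analysis"
begin

definition locally_lipschitz_on :: "'a::metric_space set \<Rightarrow> ('a \<Rightarrow> 'b::metric_space) \<Rightarrow> bool" where
  "locally_lipschitz_on S g \<longleftrightarrow>
     (\<forall>z\<in>S. \<exists>e>0. \<exists>L. L-lipschitz_on (cball z e \<inter> S) g)"

(* Trajectories are Caratheodory solutions: an admissible input is a Lebesgue measurable signal
   with values in U, and the differential equation holds in its integral form, i.e. the state
   is locally absolutely continuous and x' = f(x,u) almost everywhere on I. *)
definition trajectory_on ::
  "('a::euclidean_space \<Rightarrow> 'b::euclidean_space \<Rightarrow> 'a) \<Rightarrow> 'a set \<Rightarrow> 'b set \<Rightarrow> real set
     \<Rightarrow> (real \<Rightarrow> 'b) \<Rightarrow> (real \<Rightarrow> 'a) \<Rightarrow> bool" where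
  "trajectory_on f X U I u x \<longleftrightarrow>
     u \<in> borel_measurable (lebesgue_on I) \<and>
     (\<forall>t\<in>I. u t \<in> U \<and> x t \<in> X) \<and>
     (\<forall>a\<in>I. \<forall>b\<in>I. a \<le> b \<longrightarrow>
        (\<lambda>r. f (x r) (u r)) absolutely_integrable_on {a..b} \<and>
        x b = x a + integral {a..b} (\<lambda>r. f (x r) (u r)))"

(* The inner Sup is the maximum of h along the trajectory; that this maximum is attained, and
   that the outer supremum is a genuine real supremum, is value_function_well_defined below. *)
definition value_function ::
  "('a::euclidean_space \<Rightarrow> 'b::euclidean_space \<Rightarrow> 'a) \<Rightarrow> 'a set \<Rightarrow> 'b set \<Rightarrow> ('a \<Rightarrow> real)
     \<Rightarrow> 'a \<Rightarrow> real \<Rightarrow> real" where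
  "value_function f X U h x t =
     Sup {(SUP s\<in>{t..0}. h (y s)) | u y. trajectory_on f X U {t..0} u y \<and> y t = x}"

definition value_function_well_defined ::
  "('a::euclidean_space \<Rightarrow> 'b::euclidean_space \<Rightarrow> 'a) \<Rightarrow> 'a set \<Rightarrow> 'b set \<Rightarrow> ('a \<Rightarrow> real)
     \<Rightarrow> bool" where
  "value_function_well_defined f X U h \<longleftrightarrow>
     (\<forall>x\<in>X. \<forall>t\<le>0.
        (\<exists>u y. trajectory_on f X U {t..0} u y \<and> y t = x) \<and>
        (\<forall>u y. trajectory_on f X U {t..0} u y \<and> y t = x \<longrightarrow>
           (\<exists>s\<in>{t..0}. \<forall>r\<in>{t..0}. h (y r) \<le> h (y s))) \<and>
        bdd_above {(SUP s\<in>{t..0}. h (y s)) | u y.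
                     trajectory_on f X U {t..0} u y \<and> y t = x})"

(* The maximum over u of p . f(x,u). U need not be closed, so it is written as a supremum;
   extended reals avoid a junk value should that supremum be infinite. *)
definition hamiltonian ::
  "('a::euclidean_space \<Rightarrow> 'b::euclidean_space \<Rightarrow> 'a) \<Rightarrow> 'b set \<Rightarrow> 'a \<Rightarrow> 'a \<Rightarrow> ereal" where
  "hamiltonian f U x p = (SUP u\<in>U. ereal (p \<bullet> f x u))"

definition C1_gradient ::
  "('a::euclidean_space \<times> real \<Rightarrow> real) \<Rightarrow> ('a \<times> real \<Rightarrow> 'a \<times> real) \<Rightarrow> bool" where
  "C1_gradient \<phi> g \<longleftrightarrow> continuous_on UNIV g \<and> (\<forall>z. GDERIV \<phi> z :> g z)"

(* Continuous viscosity solution on t \<le> 0 of the terminal value problem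
     d/dt V + max_u (grad_x V . f(x,u)) = 0,   V(x,0) = h(x).
   For a terminal value problem the inequalities are reversed with respect to the initial value
   convention: where V - \<phi> has a local maximum the left-hand side, evaluated at \<phi>, is \<ge> 0,
   where it has a local minimum it is \<le> 0. No boundary condition is imposed on the frontier
   of X. *)
definition viscosity_solution ::
  "('a::euclidean_space \<Rightarrow> 'b::euclidean_space \<Rightarrow> 'a) \<Rightarrow> 'a set \<Rightarrow> 'b set \<Rightarrow> ('a \<Rightarrow> real)
     \<Rightarrow> ('a \<Rightarrow> real \<Rightarrow> real) \<Rightarrow> bool" where
  "viscosity_solution f X U h V \<longleftrightarrow>
     continuous_on (X \<times> {..0}) (\<lambda>(x, t). V x t) \<and>
     (\<forall>x\<in>X. V x 0 = h x) \<and>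
     (\<forall>\<phi> g. C1_gradient \<phi> g \<longrightarrow>
        (\<forall>x\<in>interior X. \<forall>t<0.
           ((\<forall>\<^sub>F (y, s) in nhds (x, t). V y s - \<phi> (y, s) \<le> V x t - \<phi> (x, t)) \<longrightarrow>
              ereal (snd (g (x, t))) + hamiltonian f U x (fst (g (x, t))) \<ge> 0) \<and>
           ((\<forall>\<^sub>F (y, s) in nhds (x, t). V y s - \<phi> (y, s) \<ge> V x t - \<phi> (x, t)) \<longrightarrow>
              ereal (snd (g (x, t))) + hamiltonian f U x (fst (g (x, t))) \<le> 0)))"

(* Pred h is the predicate with predicate function h, i.e. the one that is true at x iff
   h x \<ge> 0. *)
datatype 'a stl =
    Pred "'a \<Rightarrow> real"
  | Eventually real real "'a stl"
  | Always real real "'a stl"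

primrec stl_sat :: "(real \<Rightarrow> 'a) \<Rightarrow> real \<Rightarrow> 'a stl \<Rightarrow> bool" where
  "stl_sat x t (Pred h) \<longleftrightarrow> h (x t) \<ge> 0"
| "stl_sat x t (Eventually a b \<phi>) \<longleftrightarrow> (\<exists>t1\<in>{t + a..t + b}. stl_sat x t1 \<phi>)"
| "stl_sat x t (Always a b \<phi>) \<longleftrightarrow> (\<forall>t1\<in>{t + a..t + b}. stl_sat x t1 \<phi>)"

(* The operator is only specified for t in [t0, t0 + \<beta>(\<tau>)]. *)
definition cbf_stl ::
  "(real \<Rightarrow> real) \<Rightarrow> (real \<Rightarrow> real) \<Rightarrow> ('a \<Rightarrow> real) \<Rightarrow> ('a \<Rightarrow> real \<Rightarrow> real)
     \<Rightarrow> real \<Rightarrow> 'a \<Rightarrow> real \<Rightarrow> real \<Rightarrow> real" where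
  "cbf_stl \<alpha> \<beta> h V \<tau> x t t0 =
     (if t \<in> {t0..t0 + \<alpha> \<tau>} then V x (t - \<alpha> \<tau> - t0)
      else if t \<in> {t0 + \<alpha> \<tau><..t0 + \<beta> \<tau>} then h x
      else undefined)"

end

theory Submission
  imports Defs
begin

text \<open>
  If \<open>t\<^sub>1\<close> witnesses the eventually operator, then \<open>\<tau> = t\<^sub>1 - t\<^sub>0 - tl'\<close> puts the switching
  time \<open>t\<^sub>0 + \<alpha>\<close> of the operator exactly at the beginning of the window on which \<open>h \<ge> 0\<close>.
  Before the switching time, the given trajectory is itself a competitor in the supremum
  defining the value function (the system is autonomous, so it may be shifted in time) and it ends
  in \<open>{h \<ge> 0}\<close>. Conversely, at the switching time the value function is evaluated at time 0,
  where it equals \<open>h\<close>.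
\<close>

lemma absolutely_integrable_on_shift_Icc_real:
  fixes f :: "real \<Rightarrow> 'a::euclidean_space"
  shows "(\<lambda>r. f (r + c)) absolutely_integrable_on {a..b} \<longleftrightarrow> f absolutely_integrable_on {a + c..b + c}"
  using integrable_on_shift_Icc_real[of f c a b] integrable_on_shift_Icc_real[of "\<lambda>r. norm (f r)" c a b]
  by (simp add: absolutely_integrable_on_def o_def add.commute)

lemma trajectory_on_shift:
  assumes "trajectory_on f X U UNIV u x"
  shows "trajectory_on f X U I (\<lambda>r. u (r + c)) (\<lambda>r. x (r + c))"
  unfolding trajectory_on_def
proof (intro conjI ballI impI)
  \<comment> \<open>Since \<open>u\<close> is only Lebesgue measurable, the translation has to be
    measurable from \<open>lebesgue\<close> to \<open>lebesgue\<close>; Borel measurability would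
    not compose with \<open>u\<close>.\<close>
  have "(\<lambda>r::real. r + c) \<in> lebesgue \<rightarrow>\<^sub>M lebesgue"
    using lebesgue_affine_measurable[of "\<lambda>_::real. 1" c] by (simp add: add.commute)
  moreover have "u \<in> borel_measurable lebesgue"
    using assms by (simp add: trajectory_on_def lebesgue_on_UNIV_eq)
  ultimately have "(\<lambda>r. u (r + c)) \<in> borel_measurable lebesgue"
    by (rule measurable_compose)
  then show "(\<lambda>r. u (r + c)) \<in> borel_measurable (lebesgue_on I)"
    by (rule measurable_restrict_space1)
next
  fix t
  show "u (t + c) \<in> U" "x (t + c) \<in> X"
    using assms by (simp_all add: trajectory_on_def)
next
  fix a b :: real
  assume "a \<le> b"
  then have *: "(\<lambda>r. f (x r) (u r)) absolutely_integrable_on {a + c..b + c}"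
    "x (b + c) = x (a + c) + integral {a + c..b + c} (\<lambda>r. f (x r) (u r))"
    using assms by (simp_all add: trajectory_on_def)
  show "(\<lambda>r. f (x (r + c)) (u (r + c))) absolutely_integrable_on {a..b}"
    using *(1) absolutely_integrable_on_shift_Icc_real[where f = "\<lambda>r. f (x r) (u r)"] by simp
  show "x (b + c) = x (a + c) + integral {a..b} (\<lambda>r. f (x (r + c)) (u (r + c)))"
    using *(2) integral_shift_Icc_real[where a = a and b = b and c = c and f = "\<lambda>r. f (x r) (u r)"]
    by (simp add: o_def add.commute[of c])
qed

text \<open>Both nested real suprema are controlled by well-definedness: the attained maximum bounds
  the inner set, and the outer set, which contains the value of \<open>y\<close>, is bounded
  above.\<close>

lemma value_function_ge:
  assumes "value_function_well_defined f X U h"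
    and "trajectory_on f X U {t..0} u y" and "t \<le> 0" and "s \<in> {t..0}"
  shows "h (y s) \<le> value_function f X U h (y t) t"
proof -
  have "y t \<in> X"
    using assms by (simp add: trajectory_on_def)
  note wd = assms(1)[unfolded value_function_well_defined_def, rule_format, OF this assms(3)]
  from wd assms(2) have max: "\<exists>s\<in>{t..0}. \<forall>r\<in>{t..0}. h (y r) \<le> h (y s)"
    and bdd: "bdd_above {(SUP s\<in>{t..0}. h (z s)) | v z. trajectory_on f X U {t..0} v z \<and> z t = y t}"
    by simp_all
  from max have "bdd_above ((\<lambda>s. h (y s)) ` {t..0})"
    by (auto intro: bdd_aboveI2)
  then have "h (y s) \<le> (SUP s\<in>{t..0}. h (y s))"
    using \<open>s \<in> {t..0}\<close> by (rule cSUP_upper2) simp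
  also have "\<dots> \<le> value_function f X U h (y t) t"
    unfolding value_function_def using assms(2) by (intro cSup_upper bdd) blast
  finally show ?thesis .
qed

text \<open>Translating by \<open>T\<close> moves time \<open>T\<close> to 0, the end of the
  horizon, and \<open>t\<close> to \<open>t - T\<close>; the bound is then read off at
  \<open>s = 0\<close>.\<close>

lemma value_function_ge_along_trajectory:
  assumes "value_function_well_defined f X U h"
    and "trajectory_on f X U UNIV u x" and "t \<le> T"
  shows "h (x T) \<le> value_function f X U h (x t) (t - T)"
  using value_function_ge[OF assms(1) trajectory_on_shift[OF assms(2), of _ T], of "t - T" 0] assms(3)
  by simp

theorem proposition9:
  fixes f :: "real^'n \<Rightarrow> real^'m \<Rightarrow> real^'n"
    and X :: "(real^'n) set" and U :: "(real^'m) set"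
    and h :: "real^'n \<Rightarrow> real"
    and tl tu tl' tu' :: real
    and \<Theta> :: "real set" and \<alpha> \<beta> :: "real \<Rightarrow> real"
    and u :: "real \<Rightarrow> real^'m" and x :: "real \<Rightarrow> real^'n"
  assumes "locally_lipschitz_on (X \<times> U) (\<lambda>(x, u). f x u)"
    and "convex U" and "bounded U"
    and "value_function_well_defined f X U h"
    and "viscosity_solution f X U h (value_function f X U h)"
    and "0 \<le> tl" and "tl \<le> tu"
    and "0 \<le> tl'" and "tl' \<le> tu'"
    and "\<Theta> = {0..tu' - tl'}"
    and "\<And>\<tau>. \<tau> \<in> \<Theta> \<Longrightarrow> \<alpha> \<tau> = tl + tl' + \<tau>"
    and "\<And>\<tau>. \<tau> \<in> \<Theta> \<Longrightarrow> \<beta> \<tau> = tu + tl' + \<tau>"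
    and "trajectory_on f X U UNIV u x"
  shows "\<forall>t0::real.
    (\<exists>\<tau>::real \<Rightarrow> real. (\<forall>s. \<tau> s \<in> \<Theta>) \<and>
       (\<forall>t\<in>{t0..t0 + \<beta> (\<tau> t0)}.
          cbf_stl \<alpha> \<beta> h (value_function f X U h) (\<tau> t0) (x t) t t0 \<ge> 0))
    \<longleftrightarrow> stl_sat x t0 (Eventually tl' tu' (Always tl tu (Pred h)))"
proof (intro allI iffI)
  let ?V = "value_function f X U h"
  fix t0 :: real
  assume "\<exists>\<tau>::real \<Rightarrow> real. (\<forall>s. \<tau> s \<in> \<Theta>) \<and>
    (\<forall>t\<in>{t0..t0 + \<beta> (\<tau> t0)}. cbf_stl \<alpha> \<beta> h ?V (\<tau> t0) (x t) t t0 \<ge> 0)"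
  \<comment> \<open>Only the value at \<open>t0\<close> enters the condition, so the function is
    replaced by that real number.\<close>
  then obtain \<tau> where \<tau>: "\<tau> \<in> \<Theta>"
    and nonneg: "\<And>t. t \<in> {t0..t0 + \<beta> \<tau>} \<Longrightarrow> cbf_stl \<alpha> \<beta> h ?V \<tau> (x t) t t0 \<ge> 0"
    by blast
  have "0 \<le> \<tau>" "\<tau> \<le> tu' - tl'"
    using \<tau> assms(10) by auto
  note [simp] = assms(11)[OF \<tau>] assms(12)[OF \<tau>]
  \<comment> \<open>This is the terminal condition, available because the trajectory stays in
    \<open>X\<close>.\<close>
  have V0: "?V (x t) 0 = h (x t)" for t
    using assms(5,13) by (simp add: viscosity_solution_def trajectory_on_def)
  have "h (x t) \<ge> 0" if "t \<in> {t0 + tl' + \<tau> + tl..t0 + tl' + \<tau> + tu}" for t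
  \<comment> \<open>The left end of the window still belongs to the value function branch, at time
    argument 0; only later times reach the branch \<open>h\<close>.\<close>
  proof (cases "t = t0 + \<alpha> \<tau>")
    case True
    then show ?thesis
      using nonneg[of t] that \<open>0 \<le> \<tau>\<close> assms(6-9) V0[of t] by (simp add: cbf_stl_def)
  next
    case False
    then show ?thesis
      using nonneg[of t] that \<open>0 \<le> \<tau>\<close> assms(6-9) by (simp add: cbf_stl_def split: if_splits)
  qed
  then show "stl_sat x t0 (Eventually tl' tu' (Always tl tu (Pred h)))"
    using \<open>0 \<le> \<tau>\<close> \<open>\<tau> \<le> tu' - tl'\<close> by (auto intro!: bexI[of _ "t0 + tl' + \<tau>"])
next
  let ?V = "value_function f X U h"
  fix t0 :: real
  assume "stl_sat x t0 (Eventually tl' tu' (Always tl tu (Pred h)))"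
  then obtain t1 where t1: "t1 \<in> {t0 + tl'..t0 + tu'}"
    and sat: "\<And>t. t \<in> {t1 + tl..t1 + tu} \<Longrightarrow> h (x t) \<ge> 0"
    by auto
  define \<tau> where "\<tau> = t1 - t0 - tl'"
  have \<tau>: "\<tau> \<in> \<Theta>"
    using t1 assms(10) by (simp add: \<tau>_def)
  have \<alpha>: "t0 + \<alpha> \<tau> = t1 + tl" and \<beta>: "t0 + \<beta> \<tau> = t1 + tu"
    using assms(11,12)[OF \<tau>] by (simp_all add: \<tau>_def)
  have "cbf_stl \<alpha> \<beta> h ?V \<tau> (x t) t t0 \<ge> 0" if t: "t \<in> {t0..t0 + \<beta> \<tau>}" for t
  proof (cases "t \<le> t1 + tl")
    case True
    \<comment> \<open>The switching time lies in the window since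
      \<open>tl \<le> tu\<close>.\<close>
    have "0 \<le> h (x (t1 + tl))"
      using sat assms(7) by simp
    also have "\<dots> \<le> ?V (x t) (t - (t1 + tl))"
      using assms(4,13) True by (rule value_function_ge_along_trajectory)
    also have "t - (t1 + tl) = t - \<alpha> \<tau> - t0"
      using \<alpha> by simp
    finally show ?thesis
      using True t \<alpha> by (simp add: cbf_stl_def)
  next
    case False
    then show ?thesis
      using t \<alpha> \<beta> sat[of t] by (simp add: cbf_stl_def)
  qed
  with \<tau> show "\<exists>\<tau>::real \<Rightarrow> real. (\<forall>s. \<tau> s \<in> \<Theta>) \<and>
    (\<forall>t\<in>{t0..t0 + \<beta> (\<tau> t0)}. cbf_stl \<alpha> \<beta> h ?V (\<tau> t0) (x t) t t0 \<ge> 0)"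
    \<comment> \<open>A constant function suffices, as its values at other times are constrained
      only to lie in \<open>\<Theta>\<close>.\<close>
    by (intro exI[of _ "\<lambda>_. \<tau>"]) simp
qed

end
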